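(* Let $\Phi=(D,\varphi)$ be a $\mathbb{T}$-gain digraph. Then $\Phi$ is cycle balanced if and only if $A(\Phi)$ is cospectral with $A(D)$.
   Context: A digraph $D=(V,\mathcal{A})$ has a finite vertex set $V=\{v_1,\dots,v_n\}$ and a set $\mathcal{A}$ of ordered pairs of distinct vertices, called arcs (no loops; at most one arc from $v_i$ to $v_j$ for each ordered pair; opposite arcs $(u,v)$, $(v,u)$ may both be present). A directed cycle is a closed directed walk whose vertices are distinct except that the first and last coincide (so its length is at least $2$; a cycle of length $2$, i.e. a pair of opposite arcs, is allowed). Let $\mathbb{T}=\{z\in\mathbb{C}:|z|=1\}$. A $\mathbb{T}$-gain digraph is a pair $\Phi=(D,\varphi)$ with $D$ a digraph and $\varphi:\mathcal{A}\to\mathbb{T}$ an arbitrary function (no relation between the gains of opposite arcs is imposed). Its gain adjacency matrix $A(\Phi)\in M_n(\mathbb{C})$ has entries $A(\Phi)_{ij}=\varphi(v_i,v_j)$ if $(v_i,v_j)\in\mathcal{A}$ and $0$ otherwise. $A(D)$ is the $0/1$ adjacency matrix, $A(D)_{ij}=1$ if $(v_i,v_j)\in\mathcal{A}$ and $0$ otherwise. The gain $\varphi(C)$ of a directed cycle $C$ is the product of the gains of its arcs. $\Phi$ is cycle balanced if $\varphi(C)=1$ for every directed cycle $C$ of $D$. Two matrices are cospectral if they have the same characteristic polynomial. *)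

theory Defs
  imports
    Complex_Main
    "Graph_Theory.Pair_Digraph"
    "Jordan_Normal_Form.Char_Poly"
begin

text \<open>
  Only the values of \<open>\<phi>\<close> on arcs matter; the gains of opposite arcs are unrelated.
\<close>
locale T_gain_digraph = pair_digraph D
  for D :: "'a pair_pre_digraph" +
  fixes \<phi> :: "'a \<times> 'a \<Rightarrow> complex"
  assumes gain_unit: "e \<in> parcs D \<Longrightarrow> cmod (\<phi> e) = 1"

text \<open>
  A list \<open>vs\<close> enumerates the vertices and fixes the order of rows and columns (0-based indices).
\<close>
definition vertex_enum :: "'a pair_pre_digraph \<Rightarrow> 'a list \<Rightarrow> bool" where
  "vertex_enum D vs \<longleftrightarrow> distinct vs \<and> set vs = pverts D"

definition adj_matrix :: "'a pair_pre_digraph \<Rightarrow> 'a list \<Rightarrow> complex mat" where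
  "adj_matrix D vs = mat (length vs) (length vs)
     (\<lambda>(i, j). if (vs ! i, vs ! j) \<in> parcs D then 1 else 0)"

definition gain_adj_matrix ::
  "'a pair_pre_digraph \<Rightarrow> ('a \<times> 'a \<Rightarrow> complex) \<Rightarrow> 'a list \<Rightarrow> complex mat" where
  "gain_adj_matrix D \<phi> vs = mat (length vs) (length vs)
     (\<lambda>(i, j). if (vs ! i, vs ! j) \<in> parcs D then \<phi> (vs ! i, vs ! j) else 0)"

definition walk_gain :: "('a \<times> 'a \<Rightarrow> complex) \<Rightarrow> ('a \<times> 'a) awalk \<Rightarrow> complex" where
  "walk_gain \<phi> p = prod_list (map \<phi> p)"

text \<open>
  \<open>pre_digraph.cycle\<close> is the directed cycle of the graph library, given by its list of arcs:
  a nonempty closed walk whose vertices are distinct except for the first and the last.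
  It would admit loops, but a \<open>pair_digraph\<close> has none, so every cycle has length at least 2;
  a pair of opposite arcs is a cycle.
\<close>
definition cycle_balanced :: "'a pair_pre_digraph \<Rightarrow> ('a \<times> 'a \<Rightarrow> complex) \<Rightarrow> bool" where
  "cycle_balanced D \<phi> \<longleftrightarrow> (\<forall>C. pre_digraph.cycle (with_proj D) C \<longrightarrow> walk_gain \<phi> C = 1)"

definition cospectral :: "complex mat \<Rightarrow> complex mat \<Rightarrow> bool" where
  "cospectral A B \<longleftrightarrow> char_poly A = char_poly B"

end

theory Submission
  imports Defs "Jordan_Normal_Form.Schur_Decomposition"
begin

text \<open>
  The trace of the \<open>k\<close>-th power of \<open>A(\<Phi>)\<close> is the sum of the gains of all closed walks of
  length \<open>k\<close>, and over the complex numbers the traces of all powers determine the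
  characteristic polynomial and conversely. If \<open>\<Phi>\<close> is cycle balanced, every closed walk has
  gain 1, because it decomposes into cycles, so the traces agree with those of \<open>A(D)\<close>.
  If conversely the traces agree, then for each \<open>k\<close> the gains of the closed walks of length \<open>k\<close>
  are unit complex numbers whose sum equals their number, which forces each of them to be 1.
\<close>

section \<open>Traces of powers and the characteristic polynomial\<close>

definition mat_trace :: "'a::comm_ring_1 mat \<Rightarrow> 'a" where
  "mat_trace A = (\<Sum>i<dim_row A. A $$ (i, i))"

lemma mat_trace_mult_commute:
  fixes A B :: "'a::comm_ring_1 mat"
  assumes "A \<in> carrier_mat n m" "B \<in> carrier_mat m n"
  shows "mat_trace (A * B) = mat_trace (B * A)"
proof -
  have "mat_trace (A * B) = (\<Sum>i<n. \<Sum>j<m. A $$ (i, j) * B $$ (j, i))"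
    using assms by (auto simp: mat_trace_def scalar_prod_def atLeast0LessThan)
  also have "\<dots> = (\<Sum>j<m. \<Sum>i<n. B $$ (j, i) * A $$ (i, j))"
    by (subst sum.swap) (simp add: mult.commute)
  also have "\<dots> = mat_trace (B * A)"
    using assms by (auto simp: mat_trace_def scalar_prod_def atLeast0LessThan)
  finally show ?thesis .
qed

text \<open>Cyclicity moves \<open>Q\<close> to the front of \<open>P * B * Q\<close>, where it
  cancels against \<open>P\<close>.\<close>

lemma mat_trace_similar:
  fixes A B :: "'a::comm_ring_1 mat"
  assumes "similar_mat_wit A B P Q"
  shows "mat_trace A = mat_trace B"
proof -
  note D = similar_mat_witD[OF refl assms]
  have "mat_trace A = mat_trace (P * B * Q)"
    using D(3) by simp
  also have "\<dots> = mat_trace (Q * (P * B))"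
    by (rule mat_trace_mult_commute[OF mult_carrier_mat[OF D(6) D(5)] D(7)])
  also have "Q * (P * B) = Q * P * B"
    by (rule assoc_mult_mat[OF D(7) D(6) D(5), symmetric])
  also have "\<dots> = B"
    unfolding D(2) by (rule left_mult_one_mat[OF D(5)])
  finally show ?thesis .
qed

text \<open>In the sum over the middle index \<open>k\<close>, the first factor vanishes for
  \<open>k < i\<close> and the second for \<open>k > j\<close>; since \<open>j \<le> i\<close>, only
  \<open>k = i = j\<close> can contribute. Treating \<open>j < i\<close> and \<open>j = i\<close>
  together yields both triangularity and the diagonal for powers.\<close>

lemma upper_triangular_mult_diag:
  fixes A B :: "'a::comm_ring_1 mat"
  assumes "A \<in> carrier_mat n n" "B \<in> carrier_mat n n"
    and "upper_triangular A" "upper_triangular B" "j \<le> i" "i < n"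
  shows "(A * B) $$ (i, j) = (if i = j then A $$ (i, i) * B $$ (i, i) else 0)"
proof -
  have "(A * B) $$ (i, j) = (\<Sum>k<n. A $$ (i, k) * B $$ (k, j))"
    using assms by (auto simp: scalar_prod_def atLeast0LessThan)
  also have "\<dots> = (\<Sum>k<n. if k = i then (if i = j then A $$ (i, i) * B $$ (i, i) else 0) else 0)"
  proof (rule sum.cong)
    fix k assume k: "k \<in> {..<n}"
    consider "k < i" | "k = i" "j = i" | "k = i" "j < i" | "k > i" using assms(5) by linarith
    then show "A $$ (i, k) * B $$ (k, j)
        = (if k = i then (if i = j then A $$ (i, i) * B $$ (i, i) else 0) else 0)"
      using assms k upper_triangularD[OF assms(3), of k i] upper_triangularD[OF assms(4), of j k]
      by cases auto
  qed simp
  also have "\<dots> = (if i = j then A $$ (i, i) * B $$ (i, i) else 0)"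
    using assms by simp
  finally show ?thesis .
qed

lemma upper_triangular_pow:
  fixes A :: "'a::comm_ring_1 mat"
  assumes A: "A \<in> carrier_mat n n" "upper_triangular A"
  shows "upper_triangular (A ^\<^sub>m k) \<and> (\<forall>i<n. (A ^\<^sub>m k) $$ (i, i) = (A $$ (i, i)) ^ k)"
proof (induction k)
  case 0
  then show ?case using A by auto
next
  case (Suc k)
  have "A ^\<^sub>m k \<in> carrier_mat n n" using A by simp
  note mult = upper_triangular_mult_diag[OF this A(1) conjunct1[OF Suc] A(2)]
  have "upper_triangular (A ^\<^sub>m Suc k)"
    using A mult by (intro upper_triangularI) simp
  then show ?case using mult Suc by (simp add: mult.commute)
qed

text \<open>Schur decomposition makes \<open>A\<close> similar to a triangular matrix with diagonal
  \<open>es\<close>, and a power of that matrix has the powers of \<open>es\<close> on its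
  diagonal.\<close>

lemma mat_trace_pow_eigenvalues:
  fixes A :: "complex mat"
  assumes A: "A \<in> carrier_mat n n" and c: "char_poly A = (\<Prod>e\<leftarrow>es. [:- e, 1:])"
  shows "mat_trace (A ^\<^sub>m k) = (\<Sum>e\<leftarrow>es. e ^ k)"
proof -
  obtain B P Q where "schur_decomposition A es = (B, P, Q)" by (metis surj_pair)
  from schur_decomposition[OF A c this]
  have sim: "similar_mat_wit A B P Q" and ut: "upper_triangular B" and d: "diag_mat B = es"
    by auto
  have B: "B \<in> carrier_mat n n" using similar_mat_witD2[OF A sim] by simp
  have "mat_trace (A ^\<^sub>m k) = mat_trace (B ^\<^sub>m k)"
    by (rule mat_trace_similar[OF similar_mat_wit_pow[OF sim]])
  also have "\<dots> = (\<Sum>i<n. (B $$ (i, i)) ^ k)"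
    using upper_triangular_pow[OF B ut] B by (auto simp: mat_trace_def)
  also have "\<dots> = (\<Sum>e\<leftarrow>es. e ^ k)"
    using B by (simp add: d[symmetric] diag_mat_def comp_def sum_set_upt_conv_sum_list_nat[symmetric]
        atLeast0LessThan del: sum_set_upt_conv_sum_list_nat)
  finally show ?thesis .
qed

text \<open>Summing the values of \<open>q\<close> over a list is a linear combination of the power
  sums of that list, with the coefficients of \<open>q\<close>.\<close>

lemma sum_list_poly_eq:
  fixes xs ys :: "'a::comm_ring_1 list"
  assumes "\<And>k. (\<Sum>x\<leftarrow>xs. x ^ k) = (\<Sum>x\<leftarrow>ys. x ^ k)"
  shows "(\<Sum>x\<leftarrow>xs. poly q x) = (\<Sum>x\<leftarrow>ys. poly q x)"
proof -
  have "(\<Sum>x\<leftarrow>zs. poly q x) = (\<Sum>i\<le>degree q. coeff q i * (\<Sum>x\<leftarrow>zs. x ^ i))" for zs :: "'a list"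
    by (induction zs) (auto simp: poly_altdef distrib_left sum.distrib)
  then show ?thesis using assms by simp
qed

lemma power_sums_imp_mset_eq:
  fixes xs ys :: "'a::field_char_0 list"
  assumes eq: "\<And>k. (\<Sum>x\<leftarrow>xs. x ^ k) = (\<Sum>x\<leftarrow>ys. x ^ k)"
  shows "mset xs = mset ys"
proof (rule multiset_eqI)
  fix a
  \<comment> \<open>A polynomial that among all entries of both lists is nonzero only at \<open>a\<close>.\<close>
  define q where "q = (\<Prod>b\<in>(set xs \<union> set ys) - {a}. [:- b, 1:])"
  have nz: "poly q a \<noteq> 0" by (auto simp: q_def poly_prod)
  have z: "poly q x = 0" if "x \<in> set xs \<union> set ys" "x \<noteq> a" for x
    using that by (auto simp: q_def poly_prod prod_zero_iff intro!: bexI[of _ x])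
  \<comment> \<open>Only occurrences of \<open>a\<close> contribute, so the sum reads off the
    multiplicity of \<open>a\<close>; characteristic 0 later turns equal images of the counts into
    equal counts.\<close>
  have cnt: "(\<Sum>x\<leftarrow>zs. poly q x) = of_nat (count (mset zs) a) * poly q a"
    if "set zs \<subseteq> set xs \<union> set ys" for zs
    using that by (induction zs) (auto simp: z algebra_simps)
  have "of_nat (count (mset xs) a) * poly q a = of_nat (count (mset ys) a) * poly q a"
    using sum_list_poly_eq[OF eq, where q = q] by (simp add: cnt)
  then show "count (mset xs) a = count (mset ys) a" using nz by simp
qed

lemma char_poly_eq_iff_mat_trace_pow:
  fixes A B :: "complex mat"
  assumes A: "A \<in> carrier_mat n n" and B: "B \<in> carrier_mat n n"
  shows "char_poly A = char_poly B \<longleftrightarrow> (\<forall>k. mat_trace (A ^\<^sub>m k) = mat_trace (B ^\<^sub>m k))"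
proof -
  obtain as bs where a: "char_poly A = (\<Prod>e\<leftarrow>as. [:- e, 1:])"
    and b: "char_poly B = (\<Prod>e\<leftarrow>bs. [:- e, 1:])"
    using char_poly_factorized[OF A] char_poly_factorized[OF B] by blast
  show ?thesis
  proof
    assume "char_poly A = char_poly B"
    then show "\<forall>k. mat_trace (A ^\<^sub>m k) = mat_trace (B ^\<^sub>m k)"
      \<comment> \<open>By assumption \<open>as\<close> also lists the roots of
        \<open>char_poly B\<close>, so both traces are power sums of the same list.\<close>
      using mat_trace_pow_eigenvalues[OF A a] mat_trace_pow_eigenvalues[OF B, of as] a by simp
  next
    assume "\<forall>k. mat_trace (A ^\<^sub>m k) = mat_trace (B ^\<^sub>m k)"
    then have "mset as = mset bs"
      using mat_trace_pow_eigenvalues[OF A a] mat_trace_pow_eigenvalues[OF B b]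
      by (intro power_sums_imp_mset_eq) simp
    then show "char_poly A = char_poly B"
      unfolding a b by (metis mset_map prod_mset_prod_list)
  qed
qed

section \<open>Gains of closed walks\<close>

lemma walk_gain_Nil [simp]: "walk_gain \<phi> [] = 1"
  and walk_gain_Cons [simp]: "walk_gain \<phi> (e # p) = \<phi> e * walk_gain \<phi> p"
  and walk_gain_append [simp]: "walk_gain \<phi> (p @ q) = walk_gain \<phi> p * walk_gain \<phi> q"
  by (simp_all add: walk_gain_def)

lemma walk_gain_one [simp]: "walk_gain (\<lambda>_. 1) p = 1"
  by (induction p) auto

text \<open>With constant gain 1, one trace formula serves both matrices, and for
  \<open>A(D)\<close> it counts closed walks.\<close>

lemma adj_matrix_eq_gain_adj_matrix: "adj_matrix D vs = gain_adj_matrix D (\<lambda>_. 1) vs"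
  by (simp add: adj_matrix_def gain_adj_matrix_def)

lemma gain_adj_matrix_carrier: "gain_adj_matrix D \<phi> vs \<in> carrier_mat (length vs) (length vs)"
  by (simp add: gain_adj_matrix_def)

context pair_wf_digraph
begin

text \<open>Strong induction on the length: a closed walk that is not a cycle contains a shorter
  closed walk whose removal leaves a closed walk, and gains multiply. The base vertex is generalized
  because the removed part starts elsewhere.\<close>

lemma closed_walk_gain:
  assumes bal: "cycle_balanced G \<phi>" and "awalk u p u"
  shows "walk_gain \<phi> p = 1"
  using assms(2)
proof (induction "length p" arbitrary: u p rule: less_induct)
  case less
  show ?case
  proof (cases p)
    case Nil
    then show ?thesis by simp
  next
    case (Cons e es)
    show ?thesis
    proof (cases "distinct (tl (pawalk_verts u p))")
      case True
      then have "cycle p" using less.prems Cons by (auto simp: cycle_def)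
      then show ?thesis using bal by (simp add: cycle_balanced_def)
    next
      case False
      have w: "awalk (snd e) es u" and e: "e \<in> parcs G" "fst e = u"
        using less.prems Cons by (auto simp: awalk_Cons_iff)
      have "\<not> distinct (pawalk_verts (snd e) es)" using False Cons by simp
      \<comment> \<open>Cutting inside \<open>es\<close> keeps the arc \<open>e\<close> out of
        \<open>r\<close>, so \<open>r\<close> is strictly shorter than \<open>p\<close>; the
        remainder is shorter because \<open>r\<close> is nonempty.\<close>
      from awalk_not_distinct_decomp[OF w this]
      obtain q r s x where d: "es = q @ r @ s" "0 < length r"
        "awalk (snd e) q x" "awalk x r x" "awalk x s u" by blast
      have "awalk (snd e) (q @ s) u" using d by (metis awalk_appendI)
      then have "awalk u (e # q @ s) u" using e by (simp add: awalk_Cons_iff)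
      then have "walk_gain \<phi> (e # q @ s) = 1" using d Cons by (intro less.hyps) auto
      moreover have "walk_gain \<phi> r = 1" using d Cons by (intro less.hyps) auto
      ultimately show ?thesis using d(1) Cons by simp
    qed
  qed
qed

definition walks :: "nat \<Rightarrow> 'a \<Rightarrow> 'a \<Rightarrow> ('a \<times> 'a) awalk set" where
  "walks k u v = {p. awalk u p v \<and> length p = k}"

lemma walks_0: "u \<in> pverts G \<Longrightarrow> walks 0 u v = (if u = v then {[]} else {})"
  by (auto simp: walks_def awalk_Nil_iff)

text \<open>Arcs are split off at the end of a walk because \<open>A ^\<^sub>m Suc k\<close> unfolds
  to \<open>A ^\<^sub>m k * A\<close>.\<close>

lemma snoc_in_walks_Suc:
  "p @ [(v, w)] \<in> walks (Suc k) u w \<longleftrightarrow> p \<in> walks k u v \<and> (v, w) \<in> parcs G"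
proof
  assume "p @ [(v, w)] \<in> walks (Suc k) u w"
  then show "p \<in> walks k u v \<and> (v, w) \<in> parcs G"
    by (auto simp: walks_def awalk_simps)
next
  assume "p \<in> walks k u v \<and> (v, w) \<in> parcs G"
  then show "p @ [(v, w)] \<in> walks (Suc k) u w"
    by (auto simp: walks_def awalk_simps in_arcsD2 simp del: awalk_append_iff intro!: awalk_appendI[of u p v])
qed

lemma walks_SucE:
  assumes "p \<in> walks (Suc k) u w"
  obtains q v where "p = q @ [(v, w)]" "q \<in> walks k u v" "(v, w) \<in> parcs G"
proof -
  obtain q v w' where p: "p = q @ [(v, w')]"
    using assms by (cases p rule: rev_cases) (auto simp: walks_def)
  then have "w' = w" using assms by (auto simp: walks_def awalk_simps)
  then show thesis using that p assms snoc_in_walks_Suc by simp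
qed

end

section \<open>Entries of matrix powers as sums over walks\<close>

context pair_fin_digraph
begin

lemma finite_walks: "finite (walks k u v)"
proof (rule finite_subset)
  show "walks k u v \<subseteq> {p. set p \<subseteq> parcs G \<and> length p = k}"
    by (auto simp: walks_def awalk_def)
qed (rule finite_lists_length_eq[OF pair_finite_arcs])

lemma gain_adj_matrix_pow_entry:
  assumes vs: "vertex_enum G vs" and "i < length vs" "j < length vs"
  shows "(gain_adj_matrix G \<phi> vs ^\<^sub>m k) $$ (i, j) = (\<Sum>p\<in>walks k (vs ! i) (vs ! j). walk_gain \<phi> p)"
  using assms(3)
proof (induction k arbitrary: j)
  case 0
  have "vs ! i \<in> pverts G"
    using vs assms(2) nth_mem unfolding vertex_enum_def by metis
  moreover have "vs ! i = vs ! j \<longleftrightarrow> i = j"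
    using vs assms(2) 0 nth_eq_iff_index_eq unfolding vertex_enum_def by metis
  ultimately show ?case using assms(2) 0 by (simp add: walks_0 gain_adj_matrix_def)
next
  case (Suc k)
  let ?A = "gain_adj_matrix G \<phi> vs" and ?n = "length vs"
  let ?M = "{m. m < ?n \<and> (vs ! m, vs ! j) \<in> parcs G}"
  have "(?A ^\<^sub>m Suc k) $$ (i, j) = (\<Sum>m<?n. (?A ^\<^sub>m k) $$ (i, m) * ?A $$ (m, j))"
    using assms(2) Suc.prems gain_adj_matrix_carrier[of G \<phi> vs]
    by (simp add: scalar_prod_def atLeast0LessThan)
  also have "\<dots> = (\<Sum>m\<in>?M. (?A ^\<^sub>m k) $$ (i, m) * \<phi> (vs ! m, vs ! j))"
    using Suc.prems by (intro sum.mono_neutral_cong_right) (auto simp: gain_adj_matrix_def)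
  also have "\<dots> = (\<Sum>m\<in>?M. \<Sum>p\<in>walks k (vs ! i) (vs ! m). walk_gain \<phi> (p @ [(vs ! m, vs ! j)]))"
    by (intro sum.cong) (auto simp: Suc.IH sum_distrib_right)
  also have "\<dots> = (\<Sum>m\<in>?M. \<Sum>p\<in>(\<lambda>p. p @ [(vs ! m, vs ! j)]) ` walks k (vs ! i) (vs ! m). walk_gain \<phi> p)"
    by (simp add: sum.reindex inj_on_def)
  also have "\<dots> = (\<Sum>p\<in>walks (Suc k) (vs ! i) (vs ! j). walk_gain \<phi> p)"
  proof -
    \<comment> \<open>The walks are sorted by their penultimate vertex. It has an index since
      \<open>vs\<close> lists all vertices, and distinctness of \<open>vs\<close> makes the classes
      disjoint.\<close>
    have "walks (Suc k) (vs ! i) (vs ! j)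
        = (\<Union>m\<in>?M. (\<lambda>p. p @ [(vs ! m, vs ! j)]) ` walks k (vs ! i) (vs ! m))" (is "_ = ?U")
    proof (intro equalityI subsetI)
      fix p assume "p \<in> walks (Suc k) (vs ! i) (vs ! j)"
      then obtain q v where q: "p = q @ [(v, vs ! j)]" "q \<in> walks k (vs ! i) v" "(v, vs ! j) \<in> parcs G"
        by (rule walks_SucE)
      then obtain m where "m < ?n" "v = vs ! m"
        using vs in_arcsD1 by (metis in_set_conv_nth vertex_enum_def)
      then show "p \<in> ?U" using q by auto
    qed (auto simp: snoc_in_walks_Suc)
    moreover have "vs ! m \<noteq> vs ! m'" if "m < ?n" "m' < ?n" "m \<noteq> m'" for m m'
      using vs that by (simp add: vertex_enum_def nth_eq_iff_index_eq)
    ultimately show ?thesis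
      by (subst sum.UNION_disjoint[symmetric]) (auto simp: finite_walks)
  qed
  finally show ?case .
qed

end

section \<open>Sums of unit complex numbers and the equivalence\<close>

lemma (in T_gain_digraph) cmod_walk_gain:
  assumes "awalk u p v"
  shows "cmod (walk_gain \<phi> p) = 1"
  using assms by (induction p arbitrary: u) (auto simp: awalk_Cons_iff norm_mult gain_unit)

lemma unit_eq_one_if_Re_ge:
  assumes "cmod z = 1" "Re z \<ge> 1"
  shows "z = 1"
proof -
  have "Re z = 1" using assms complex_Re_le_cmod[of z] by simp
  then show ?thesis using assms(1) by (simp add: complex_eq_iff cmod_def)
qed

text \<open>The numbers \<open>1 - Re (f y)\<close> are nonnegative and sum to 0, so each vanishes;
  a unit number with real part 1 is 1.\<close>

lemma sum_unit_eq_card_imp_one: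
  fixes f :: "'a \<Rightarrow> complex"
  assumes "finite S" "\<And>x. x \<in> S \<Longrightarrow> cmod (f x) = 1" "sum f S = of_nat (card S)" "x \<in> S"
  shows "f x = 1"
proof -
  have le: "0 \<le> 1 - Re (f y)" if "y \<in> S" for y
    using assms(2)[OF that] complex_Re_le_cmod[of "f y"] by simp
  have "(\<Sum>y\<in>S. Re (f y)) = real (card S)"
    using arg_cong[OF assms(3), of Re] by simp
  then have "(\<Sum>y\<in>S. 1 - Re (f y)) = 0" by (simp add: sum_subtractf)
  then have "1 - Re (f x) = 0"
    using sum_nonneg_eq_0_iff[OF assms(1) le] assms(4) by simp
  then show ?thesis using assms(2,4) by (intro unit_eq_one_if_Re_ge) auto
qed

theorem theorem2p6:
  fixes D :: "'a pair_pre_digraph"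
    and \<phi> :: "'a \<times> 'a \<Rightarrow> complex"
    and vs :: "'a list"
  assumes "T_gain_digraph D \<phi>"
    and "vertex_enum D vs"
  shows "cycle_balanced D \<phi> \<longleftrightarrow> cospectral (gain_adj_matrix D \<phi> vs) (adj_matrix D vs)"
proof -
  interpret T_gain_digraph D \<phi> by fact
  let ?n = "length vs"
  \<comment> \<open>Walks are tagged with the index of their base vertex: for \<open>k = 0\<close>
    the empty walk is closed at every vertex and must be counted \<open>?n\<close> times.\<close>
  define W where "W k = (SIGMA i:{..<?n}. walks k (vs ! i) (vs ! i))" for k
  have finW: "finite (W k)" for k by (auto simp: W_def finite_walks)
  have tr: "mat_trace (gain_adj_matrix D \<psi> vs ^\<^sub>m k) = (\<Sum>(i, p)\<in>W k. walk_gain \<psi> p)" for \<psi> k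
  proof -
    have "mat_trace (gain_adj_matrix D \<psi> vs ^\<^sub>m k)
        = (\<Sum>i<?n. \<Sum>p\<in>walks k (vs ! i) (vs ! i). walk_gain \<psi> p)"
      by (auto simp: mat_trace_def gain_adj_matrix_pow_entry[OF assms(2)]
          carrier_matD[OF gain_adj_matrix_carrier])
    also have "\<dots> = (\<Sum>(i, p)\<in>W k. walk_gain \<psi> p)"
      unfolding W_def by (rule sum.Sigma) (auto simp: finite_walks)
    finally show ?thesis .
  qed
  have "cospectral (gain_adj_matrix D \<phi> vs) (adj_matrix D vs)
      \<longleftrightarrow> (\<forall>k. (\<Sum>(i, p)\<in>W k. walk_gain \<phi> p) = of_nat (card (W k)))"
    unfolding cospectral_def adj_matrix_eq_gain_adj_matrix
      char_poly_eq_iff_mat_trace_pow[OF gain_adj_matrix_carrier gain_adj_matrix_carrier] tr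
    by (simp add: case_prod_unfold)
  also have "\<dots> \<longleftrightarrow> cycle_balanced D \<phi>"
  proof
    assume "cycle_balanced D \<phi>"
    then have "walk_gain \<phi> (snd x) = 1" if "x \<in> W k" for x k
      using that closed_walk_gain by (auto simp: W_def walks_def)
    then show "\<forall>k. (\<Sum>(i, p)\<in>W k. walk_gain \<phi> p) = of_nat (card (W k))"
      by (simp add: case_prod_unfold)
  next
    assume sums: "\<forall>k. (\<Sum>(i, p)\<in>W k. walk_gain \<phi> p) = of_nat (card (W k))"
    show "cycle_balanced D \<phi>"
      unfolding cycle_balanced_def
    proof (intro allI impI)
      fix C assume "cycle C"
      then obtain u where C: "awalk u C u" by (auto simp: cycle_def)
      then have "u \<in> set vs" using assms(2) awalk_hd_in_verts by (simp add: vertex_enum_def)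
      then obtain i where i: "i < ?n" "vs ! i = u" by (auto simp: in_set_conv_nth)
      \<comment> \<open>The cycle is itself one of the closed walks counted by the trace of the
        power \<open>length C\<close>.\<close>
      then have "(i, C) \<in> W (length C)" using C by (simp add: W_def walks_def)
      moreover have "cmod (walk_gain \<phi> (snd x)) = 1" if "x \<in> W (length C)" for x
        using that cmod_walk_gain by (auto simp: W_def walks_def)
      ultimately show "walk_gain \<phi> C = 1"
        using sum_unit_eq_card_imp_one[OF finW, of "length C" "\<lambda>x. walk_gain \<phi> (snd x)" "(i, C)"] sums
        by (simp add: case_prod_unfold)
    qed
  qed
  finally show ?thesis by blast
qed

end
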